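(* Let $n$ be a positive integer and let $f(n)$ be its dual. Then: (1) $n\in\mathcal{X}$ if and only if $f(n)\in\mathcal{Y}$; (2) $n\in\mathcal{Y}$ if and only if $f(n)\in\mathcal{X}$; (3) for every integer $d\ge 0$, $|\mathcal{X}_{2^{d+1}}|=|\mathcal{Y}_{2^{d+1}}|$.
   Context: $\mathcal{T}_\infty$ is the infinite binary tree with all leaves at the same level: its vertices are the pairs $(i,j)$ of integers with $i\ge 1$, $j\ge 0$; the vertex $(i,j)$ has parent $(i+1,\lfloor j/2\rfloor)$, and the edges join each vertex to its parent. For a finite vertex set $S$, $\overline S$ is its complement and $(S,\overline S)$ is the set of edges with one end in $S$ and the other in $\overline S$. For $n\ge 1$: $\delta(n)$ is the minimum of $|(S,\overline S)|$ over all $S\subset V(\mathcal{T}_\infty)$ with $|S|=n$; $\delta_C(n)$ is the minimum over those $S$ with $|S|=n$ that induce a connected subgraph; $\delta_P(n)$ is the minimum over those $S$ with $|S|=n$ for which $\overline S$ induces a connected subgraph. $\mathcal{X}=\{n\ge 1:\delta(n)=\delta_P(n)\}$, $\mathcal{Y}=\{n\ge 1:\delta(n)=\delta_C(n)\}$, $\mathcal{X}_m=\{k\in\mathcal{X}:k<m\}$, $\mathcal{Y}_m=\{k\in\mathcal{Y}:k<m\}$. Dual function $f$ on positive integers: if $n=2^k-1$ for some $k\ge 1$ then $f(n)=n$; otherwise $f(n)=3\cdot 2^d-n-2$ where $d=\lfloor\log_2 n\rfloor$. *)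

theory Defs
  imports Complex_Main "Graph_Theory.Graph_Theory"
begin

definition parent :: "nat \<times> nat \<Rightarrow> nat \<times> nat" where
  "parent v = (fst v + 1, snd v div 2)"

text \<open>
  Following the convention of the Graph Theory library, the undirected graph is represented
  as a symmetric digraph, so each undirected edge appears as two opposite arcs.
\<close>

definition T_inf :: "(nat \<times> nat) pair_pre_digraph" where
  "T_inf = \<lparr> pverts = {(i, j). i \<ge> 1},
             parcs = (\<Union>v\<in>{(i, j). i \<ge> 1}. {(v, parent v), (parent v, v)}) \<rparr>"

lemma wf_T_inf: "pair_wf_digraph T_inf"
  by unfold_locales (auto simp: T_inf_def parent_def)

lemma sym_T_inf: "symmetric (with_proj T_inf)"
  unfolding symmetric_conv by (auto simp: T_inf_def)

lemma loopfree_T_inf: "(v, v) \<notin> parcs T_inf"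
  by (auto simp: T_inf_def parent_def)

text \<open>Edges of the cut are unordered pairs, so that each of them is counted once.\<close>

definition cut :: "(nat \<times> nat) set \<Rightarrow> (nat \<times> nat) set set" where
  "cut S = {{u, v} | u v. (u, v) \<in> parcs T_inf \<and> u \<in> S \<and> v \<in> pverts T_inf - S}"

definition vertex_sets :: "nat \<Rightarrow> (nat \<times> nat) set set" where
  "vertex_sets n = {S. S \<subseteq> pverts T_inf \<and> finite S \<and> card S = n}"

text \<open>
  \<open>connected\<close> is also the name of a topological notion, hence the qualification.
\<close>

definition induces_connected :: "(nat \<times> nat) set \<Rightarrow> bool" where
  "induces_connected U \<longleftrightarrow> Digraph_Component.connected (with_proj T_inf \<restriction> U)"

text \<open>
  The three minima are over nonempty families of natural numbers when \<open>n \<ge> 1\<close>: a path going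
  upwards from a leaf induces a connected subgraph, and deleting any set of leaves leaves a
  connected graph. \<open>Inf\<close> of a nonempty set of natural numbers is its least element.
\<close>

definition delta :: "nat \<Rightarrow> nat" where
  "delta n = Inf {card (cut S) | S. S \<in> vertex_sets n}"

definition delta_C :: "nat \<Rightarrow> nat" where
  "delta_C n = Inf {card (cut S) | S. S \<in> vertex_sets n \<and> induces_connected S}"

definition delta_P :: "nat \<Rightarrow> nat" where
  "delta_P n = Inf {card (cut S) | S. S \<in> vertex_sets n \<and> induces_connected (pverts T_inf - S)}"

definition X_set :: "nat set" where
  "X_set = {n. n \<ge> 1 \<and> delta n = delta_P n}"

definition Y_set :: "nat set" where
  "Y_set = {n. n \<ge> 1 \<and> delta n = delta_C n}"

definition X_below :: "nat \<Rightarrow> nat set" where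
  "X_below m = {k \<in> X_set. k < m}"

definition Y_below :: "nat \<Rightarrow> nat set" where
  "Y_below m = {k \<in> Y_set. k < m}"

text \<open>
  In the second case \<open>n + 2 \<le> 2 * 2 ^ d\<close>, so the natural-number subtractions never truncate.
\<close>

definition dual_fun :: "nat \<Rightarrow> nat" where
  "dual_fun n = (if \<exists>k\<ge>1. n = 2 ^ k - 1 then n
                 else 3 * 2 ^ (nat \<lfloor>log 2 (real n)\<rfloor>) - n - 2)"

end

theory Submission
  imports Defs "HOL-Library.Discrete_Functions"
begin

text \<open>
  The complete subtree below a vertex of level \<open>b\<close> has \<open>2 ^ b - 1\<close> vertices. Adding the subtrees
  at the lower ends of the edges leaving \<open>S\<close> upwards and subtracting those at the lower ends of
  the edges entering \<open>S\<close> from below recovers \<open>S\<close>. Hence a set of size \<open>n\<close> with \<open>k\<close> boundary edges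
  writes \<open>n\<close> as a signed sum of \<open>k\<close> Mersenne numbers, with all signs positive if the complement is
  connected, and with exactly one positive sign if \<open>S\<close> is connected. Conversely, optimal sums are
  realised inside complete subtrees, so the three minima become minimal lengths of such sums.

  For \<open>mers d < n < mers (d + 1)\<close>, an optimal signed sum can be chosen to contain
  \<open>mers d\<close> or \<open>mers (d + 1)\<close>, so that \<open>delta n\<close> is \<open>1\<close> plus the smaller of the signed lengths of
  \<open>n - mers d\<close> and \<open>mers (d + 1) - n\<close>. The dual of \<open>n\<close> is \<open>mers d + mers (d + 1) - n\<close>, which
  interchanges these two numbers; so \<open>delta\<close> is invariant under duality. Positive sums are optimal
  when chosen greedily, which gives \<open>delta_C n = 1 + delta_P (mers (d + 1) - n)\<close> and
  this is \<open>delta_P\<close> of the dual of \<open>n\<close>.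
\<close>

subsection \<open>Mersenne numbers\<close>

definition mers :: "nat \<Rightarrow> nat" where
  "mers b = 2 ^ b - 1"

lemma mers_0 [simp]: "mers 0 = 0"
  by (simp add: mers_def)

lemma mers_Suc: "mers (Suc b) = 2 * mers b + 1"
proof -
  have "(2::nat) ^ b \<ge> 1" by simp
  then show ?thesis unfolding mers_def power_Suc by linarith
qed

lemma mers_1 [simp]: "mers (Suc 0) = 1"
  by (simp add: mers_Suc)

lemma mers_less: "a < b \<Longrightarrow> mers a < mers b"
  by (induction rule: strict_inc_induct) (auto simp: mers_Suc)

lemma mers_mono: "a \<le> b \<Longrightarrow> mers a \<le> mers b"
  using mers_less[of a b] by (cases "a = b") auto

lemma mers_less_iff: "mers a < mers b \<longleftrightarrow> a < b"
  using mers_less mers_mono by (meson linorder_not_less)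

lemma mers_pos: "b \<ge> 1 \<Longrightarrow> mers b \<ge> 1"
  using mers_mono[of 1 b] by simp

lemma mers_interval:
  assumes "n \<ge> 1"
  obtains d where "d \<ge> 1" "mers d \<le> n" "n < mers (Suc d)"
proof
  define d where "d = floor_log (n + 1)"
  have "2 ^ d \<le> n + 1" "n + 1 < 2 * 2 ^ d"
    unfolding d_def using floor_log_exp2_le[of "n + 1"] floor_log_exp2_gt[of "n + 1"] by auto
  then show "mers d \<le> n" "n < mers (Suc d)"
    by (auto simp: mers_def)
  then show "d \<ge> 1" using assms by (cases d) auto
qed

subsection \<open>Signed sums of Mersenne numbers\<close>

text \<open>Vanishing outside 1..N lets the cutoff \<open>N\<close> grow without changing value or
  weight, so an exchange may introduce a new top index.\<close>

definition supported :: "nat \<Rightarrow> (nat \<Rightarrow> int) \<Rightarrow> bool" where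
  "supported N e \<longleftrightarrow> (\<forall>b. e b \<noteq> 0 \<longrightarrow> 1 \<le> b \<and> b \<le> N)"

definition value_of :: "nat \<Rightarrow> (nat \<Rightarrow> int) \<Rightarrow> int" where
  "value_of N e = (\<Sum>b=1..N. e b * int (mers b))"

definition weight_of :: "nat \<Rightarrow> (nat \<Rightarrow> int) \<Rightarrow> int" where
  "weight_of N e = (\<Sum>b=1..N. \<bar>e b\<bar>)"

definition srep :: "nat \<Rightarrow> int \<Rightarrow> bool" where
  "srep k n \<longleftrightarrow> (\<exists>N e. supported N e \<and> value_of N e = n \<and> weight_of N e \<le> int k)"

text \<open>
  None of the exchanges in \<open>reduce_step\<close> below increases the weight, and each of them decreases
  the following potential; so every sum has a normal form of at most the same weight.
\<close>

definition potential :: "nat \<Rightarrow> (nat \<Rightarrow> int) \<Rightarrow> int" where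
  "potential N e = (\<Sum>b=1..N. (if b = 1 then 1 else 2) * \<bar>e b\<bar>)"

text \<open>These are exactly the coefficient patterns to which no exchange applies. Coefficient 2
  survives at index 1 because replacing 2 copies of \<open>mers 1\<close> by
  \<open>mers 2 - mers 1\<close> would raise the potential.\<close>

definition normal :: "(nat \<Rightarrow> int) \<Rightarrow> bool" where
  "normal e \<longleftrightarrow> \<bar>e 1\<bar> \<le> 2 \<and> (\<forall>b\<ge>2. \<bar>e b\<bar> \<le> 1) \<and> (\<forall>b\<ge>1. e b * e (Suc b) \<ge> 0)"

lemma sum_fun_upd:
  fixes g :: "'a \<Rightarrow> 'b \<Rightarrow> 'c::ab_group_add"
  assumes "finite A" "b \<in> A"
  shows "(\<Sum>i\<in>A. g i ((e(b := x)) i)) = (\<Sum>i\<in>A. g i (e i)) + (g b x - g b (e b))"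
proof -
  have "(\<Sum>i\<in>A - {b}. g i ((e(b := x)) i)) = (\<Sum>i\<in>A - {b}. g i (e i))"
    by (rule sum.cong) auto
  then show ?thesis
    using assms by (simp add: sum.remove[of A b])
qed

lemma value_of_upd:
  "1 \<le> b \<Longrightarrow> b \<le> N \<Longrightarrow> value_of N (e(b := x)) = value_of N e + (x - e b) * int (mers b)"
  unfolding value_of_def
  by (subst sum_fun_upd[where g = "\<lambda>i y. y * int (mers i)"]) (auto simp: algebra_simps)

lemma weight_of_upd:
  "1 \<le> b \<Longrightarrow> b \<le> N \<Longrightarrow> weight_of N (e(b := x)) = weight_of N e + (\<bar>x\<bar> - \<bar>e b\<bar>)"
  unfolding weight_of_def by (subst sum_fun_upd[where g = "\<lambda>i y. \<bar>y\<bar>"]) auto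

lemma potential_upd:
  "1 \<le> b \<Longrightarrow> b \<le> N \<Longrightarrow>
    potential N (e(b := x)) = potential N e + (if b = 1 then 1 else 2) * (\<bar>x\<bar> - \<bar>e b\<bar>)"
  unfolding potential_def
  by (subst sum_fun_upd[where g = "\<lambda>i y. (if i = 1 then 1 else 2) * \<bar>y\<bar>"])
    (auto simp: algebra_simps)

lemma supported_upd: "supported N e \<Longrightarrow> 1 \<le> b \<Longrightarrow> b \<le> N \<Longrightarrow> supported N (e(b := x))"
  by (auto simp: supported_def)

lemma supported_extend:
  assumes "supported N e" "N \<le> M"
  shows "supported M e" "value_of M e = value_of N e" "weight_of M e = weight_of N e"
    "potential M e = potential N e"
proof -
  have z: "e b = 0" if "b \<in> {1..M} - {1..N}" for b
    using assms that by (auto simp: supported_def)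
  show "supported M e" using assms by (force simp: supported_def)
  show "value_of M e = value_of N e" unfolding value_of_def
    by (rule sum.mono_neutral_right) (use assms z in auto)
  show "weight_of M e = weight_of N e" unfolding weight_of_def
    by (rule sum.mono_neutral_right) (use assms z in auto)
  show "potential M e = potential N e" unfolding potential_def
    by (rule sum.mono_neutral_right) (use assms z in auto)
qed

lemmas upd_simps = value_of_upd weight_of_upd potential_upd supported_upd

text \<open>
  With \<open>c b = mers b\<close>, the exchanges are \<open>3 c 1 = c 2\<close>, \<open>2 c b = c (b + 1) - c 1\<close>,
  \<open>c 2 - c 1 = 2 c 1\<close> and \<open>c (b + 1) - c b = c b + c 1\<close>, up to a global sign \<open>s\<close>.
\<close>

lemma reduce_step:
  assumes sup: "supported N e" and nn: "\<not> normal e"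
  obtains M e' where "supported M e'" "value_of M e' = value_of N e"
    "weight_of M e' \<le> weight_of N e" "potential M e' < potential N e"
proof -
  \<comment> \<open>Leaves room for the index 2 or \<open>Suc b\<close> that an exchange may
    introduce.\<close>
  define M where "M = N + 2"
  note ext = supported_extend[OF sup, of M]
  have sN: "1 \<le> b \<and> b \<le> N" if "e b \<noteq> 0" for b
    using sup that by (auto simp: supported_def)
  consider (ones) s where "s = 1 \<or> s = -1" "s * e 1 \<ge> 3"
    | (double) s b where "s = 1 \<or> s = -1" "b \<ge> 2" "s * e b \<ge> 2"
    | (adj1) s where "s = 1 \<or> s = -1" "s * e 2 \<ge> 1" "s * e 1 \<le> -1"
    | (adj) s b where "s = 1 \<or> s = -1" "b \<ge> 2" "s * e (Suc b) \<ge> 1" "s * e b \<le> -1"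
  proof -
    from nn consider "\<bar>e 1\<bar> > 2" | b where "b \<ge> 2" "\<bar>e b\<bar> > 1"
      | b where "b \<ge> 1" "e b * e (Suc b) < 0"
      unfolding normal_def by force
    then show ?thesis
    proof cases
      case 1
      then show ?thesis using ones[of 1] ones[of "-1"] by linarith
    next
      case (2 b)
      then show ?thesis using double[of 1 b] double[of "-1" b] by linarith
    next
      case (3 b)
      then have "(e (Suc b) \<ge> 1 \<and> e b \<le> -1) \<or> (e (Suc b) \<le> -1 \<and> e b \<ge> 1)"
        by (auto simp: mult_less_0_iff)
      then show ?thesis
        using 3(1) adj[of 1 b] adj[of "-1" b] adj1[of 1] adj1[of "-1"]
        by (cases "b = 1") (auto simp: numeral_2_eq_2)
    qed
  qed
  then show thesis
  proof cases
    case ones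
    then have N: "N \<ge> 1" using sN[of 1] by auto
    define e' where "e' = e(1 := e 1 - 3 * s, 2 := e 2 + s)"
    have a: "\<bar>e 1 - 3 * s\<bar> - \<bar>e 1\<bar> = -3" "\<bar>e 2 + s\<bar> - \<bar>e 2\<bar> \<le> 1"
      using ones by auto
    show thesis
    proof (rule that[of M e'])
      show "supported M e'" "value_of M e' = value_of N e"
        using N ext by (simp_all add: e'_def M_def upd_simps mers_Suc numeral_2_eq_2)
      have "weight_of M e' = weight_of N e + (\<bar>e 1 - 3 * s\<bar> - \<bar>e 1\<bar>) + (\<bar>e 2 + s\<bar> - \<bar>e 2\<bar>)"
        using N ext by (simp add: e'_def M_def upd_simps)
      then show "weight_of M e' \<le> weight_of N e"
        using a by simp
      have "potential M e' = potential N e + (\<bar>e 1 - 3 * s\<bar> - \<bar>e 1\<bar>) + 2 * (\<bar>e 2 + s\<bar> - \<bar>e 2\<bar>)"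
        using N ext by (simp add: e'_def M_def upd_simps)
      then show "potential M e' < potential N e"
        using a by simp
    qed
  next
    case double
    then have N: "2 \<le> b" "b \<le> N" using sN[of b] by auto
    define e' where "e' = e(b := e b - 2 * s, Suc b := e (Suc b) + s, 1 := e 1 - s)"
    \<comment> \<open>The weight may stay equal, but the two units lost at \<open>b\<close> count
      double in the potential, while one of the two units gained sits at index 1 and counts
      once.\<close>
    have a: "\<bar>e b - 2 * s\<bar> - \<bar>e b\<bar> = -2" "\<bar>e (Suc b) + s\<bar> - \<bar>e (Suc b)\<bar> \<le> 1"
      "\<bar>e 1 - s\<bar> - \<bar>e 1\<bar> \<le> 1"
      using double by auto
    show thesis
    proof (rule that[of M e'])
      show "supported M e'" "value_of M e' = value_of N e"
        using N ext by (simp_all add: e'_def M_def upd_simps mers_Suc algebra_simps)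
      have "weight_of M e' = weight_of N e + (\<bar>e b - 2 * s\<bar> - \<bar>e b\<bar>) +
          (\<bar>e (Suc b) + s\<bar> - \<bar>e (Suc b)\<bar>) + (\<bar>e 1 - s\<bar> - \<bar>e 1\<bar>)"
        using N ext by (simp add: e'_def M_def upd_simps)
      then show "weight_of M e' \<le> weight_of N e"
        using a by simp
      have "potential M e' = potential N e + 2 * (\<bar>e b - 2 * s\<bar> - \<bar>e b\<bar>) +
          2 * (\<bar>e (Suc b) + s\<bar> - \<bar>e (Suc b)\<bar>) + (\<bar>e 1 - s\<bar> - \<bar>e 1\<bar>)"
        using N ext by (simp add: e'_def M_def upd_simps)
      then show "potential M e' < potential N e"
        using a by simp
    qed
  next
    case adj1
    then have N: "N \<ge> 2" using sN[of 2] by auto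
    define e' where "e' = e(1 := e 1 + 3 * s, 2 := e 2 - s)"
    \<comment> \<open>The worst case is \<open>s * e 1 = -1\<close>, which becomes 2: one unit moves
      from index 2 to index 1, where it counts less.\<close>
    have a: "\<bar>e 2 - s\<bar> - \<bar>e 2\<bar> = -1" "\<bar>e 1 + 3 * s\<bar> - \<bar>e 1\<bar> \<le> 1"
      using adj1 by auto
    show thesis
    proof (rule that[of M e'])
      show "supported M e'" "value_of M e' = value_of N e"
        using N ext by (simp_all add: e'_def M_def upd_simps mers_Suc numeral_2_eq_2)
      have "weight_of M e' = weight_of N e + (\<bar>e 1 + 3 * s\<bar> - \<bar>e 1\<bar>) + (\<bar>e 2 - s\<bar> - \<bar>e 2\<bar>)"
        using N ext by (simp add: e'_def M_def upd_simps)
      then show "weight_of M e' \<le> weight_of N e"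
        using a by simp
      have "potential M e' = potential N e + (\<bar>e 1 + 3 * s\<bar> - \<bar>e 1\<bar>) + 2 * (\<bar>e 2 - s\<bar> - \<bar>e 2\<bar>)"
        using N ext by (simp add: e'_def M_def upd_simps)
      then show "potential M e' < potential N e"
        using a by simp
    qed
  next
    case adj
    then have N: "2 \<le> b" "Suc b \<le> N" using sN[of "Suc b"] by auto
    define e' where "e' = e(b := e b + 2 * s, Suc b := e (Suc b) - s, 1 := e 1 + s)"
    have a: "\<bar>e (Suc b) - s\<bar> - \<bar>e (Suc b)\<bar> = -1" "\<bar>e b + 2 * s\<bar> - \<bar>e b\<bar> \<le> 0"
      "\<bar>e 1 + s\<bar> - \<bar>e 1\<bar> \<le> 1"
      using adj by auto
    show thesis
    proof (rule that[of M e'])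
      show "supported M e'" "value_of M e' = value_of N e"
        using N ext by (simp_all add: e'_def M_def upd_simps mers_Suc algebra_simps)
      have "weight_of M e' = weight_of N e + (\<bar>e b + 2 * s\<bar> - \<bar>e b\<bar>) +
          (\<bar>e (Suc b) - s\<bar> - \<bar>e (Suc b)\<bar>) + (\<bar>e 1 + s\<bar> - \<bar>e 1\<bar>)"
        using N ext by (simp add: e'_def M_def upd_simps)
      then show "weight_of M e' \<le> weight_of N e"
        using a by simp
      have "potential M e' = potential N e + 2 * (\<bar>e b + 2 * s\<bar> - \<bar>e b\<bar>) +
          2 * (\<bar>e (Suc b) - s\<bar> - \<bar>e (Suc b)\<bar>) + (\<bar>e 1 + s\<bar> - \<bar>e 1\<bar>)"
        using N ext by (simp add: e'_def M_def upd_simps)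
      then show "potential M e' < potential N e"
        using a by simp
    qed
  qed
qed

lemma normalise:
  assumes "supported N e"
  shows "\<exists>M e'. supported M e' \<and> normal e' \<and> value_of M e' = value_of N e \<and>
           weight_of M e' \<le> weight_of N e"
  using assms
proof (induction "nat (potential N e)" arbitrary: N e rule: less_induct)
  case less
  show ?case
  proof (cases "normal e")
    case False
    obtain M e' where *: "supported M e'" "value_of M e' = value_of N e"
      "weight_of M e' \<le> weight_of N e" "potential M e' < potential N e"
      using reduce_step[OF less.prems False] .
    have "potential M e' \<ge> 0" by (auto simp: potential_def intro!: sum_nonneg)
    then have "nat (potential M e') < nat (potential N e)" using *(4) by simp
    from less.hyps[OF this *(1)] * show ?thesis by fastforce
  qed (use less.prems in blast)
qed

section \<open>Size estimates for normal forms\<close>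

lemma value_of_0 [simp]: "value_of 0 e = 0"
  by (simp add: value_of_def)

lemma value_of_Suc: "value_of (Suc N) e = value_of N e + e (Suc N) * int (mers (Suc N))"
  by (simp add: value_of_def)

text \<open>By induction: a new top coefficient adds at most \<open>mers (Suc N)\<close> in absolute
  value, and doubling \<open>mers (Suc N)\<close> stays below the next Mersenne number. The
  coefficient 2 at index 1 is covered by \<open>2 < mers 2\<close>.\<close>

lemma normal_value_bound:
  assumes "normal e"
  shows "\<bar>value_of N e\<bar> < int (mers (Suc N))"
proof (induction N)
  case (Suc N)
  show ?case
  proof (cases N)
    case 0
    have "\<bar>e 1\<bar> \<le> 2" using assms by (simp add: normal_def)
    then show ?thesis using 0 by (simp add: value_of_Suc mers_Suc)
  next
    case (Suc m)
    then have "\<bar>e (Suc N)\<bar> \<le> 1"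
      using assms by (simp add: normal_def)
    then have "e (Suc N) = 0 \<or> e (Suc N) = 1 \<or> e (Suc N) = -1"
      by linarith
    then have "\<bar>e (Suc N) * int (mers (Suc N))\<bar> \<le> int (mers (Suc N))"
      by auto
    then show ?thesis
      using Suc.IH abs_triangle_ineq[of "value_of N e" "e (Suc N) * int (mers (Suc N))"]
      by (simp add: value_of_Suc[of N] mers_Suc[of "Suc N"])
  qed
qed simp

lemma normal_uminus: "normal e \<Longrightarrow> normal (\<lambda>b. - e b)"
  by (auto simp: normal_def)

lemma value_of_uminus: "value_of N (\<lambda>b. - e b) = - value_of N e"
  by (simp add: value_of_def sum_negf)

text \<open>The sign condition makes the coefficient just below the leading one nonnegative, so the
  lower terms cannot cancel more than about half of the leading term.\<close>

lemma normal_value_lower: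
  assumes e: "normal e" and pos: "e (Suc N) \<ge> 1"
  shows "value_of (Suc N) e > int (mers N)"
proof (cases N)
  case 0
  then show ?thesis using pos by (simp add: value_of_Suc)
next
  case (Suc m)
  have "e N * e (Suc N) \<ge> 0"
    using e Suc by (auto simp: normal_def)
  then have "e N \<ge> 0"
    using pos by (simp add: zero_le_mult_iff)
  then have "value_of N e \<ge> value_of m e"
    using Suc by (simp add: value_of_Suc)
  then have "value_of N e > - int (mers N)"
    using normal_value_bound[OF e, of m] unfolding Suc by (simp add: abs_less_iff)
  moreover have "e (Suc N) * int (mers (Suc N)) \<ge> int (mers (Suc N))"
    using mult_right_mono[OF pos, of "int (mers (Suc N))"] by simp
  moreover have "int (mers (Suc N)) = 2 * int (mers N) + 1"
    by (simp add: mers_Suc)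
  ultimately show ?thesis
    unfolding value_of_Suc by linarith
qed

text \<open>A negative leading coefficient would make the value negative. The two bounds above then
  leave only two possible leading indices for a given value.\<close>

lemma normal_top:
  assumes "normal e" "value_of N e > 0"
  shows "\<exists>t. Suc t \<le> N \<and> e (Suc t) \<ge> 1 \<and> int (mers t) < value_of N e \<and>
           value_of N e < int (mers (Suc (Suc t)))"
  using assms(2)
proof (induction N)
  case (Suc N)
  consider "e (Suc N) = 0" | "e (Suc N) \<ge> 1" | "- e (Suc N) \<ge> 1" by linarith
  then show ?case
  proof cases
    case 1
    then have "value_of (Suc N) e = value_of N e" by (simp add: value_of_Suc)
    with Suc show ?thesis by (metis le_SucI)
  next
    case 2
    then show ?thesis
      using normal_value_lower[OF assms(1) 2] normal_value_bound[OF assms(1), of "Suc N"] by auto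
  next
    case 3
    from normal_value_lower[OF normal_uminus[OF assms(1)] 3] Suc.prems show ?thesis
      by (simp add: value_of_uminus)
  qed
qed simp

section \<open>Numbers of bounded signed length\<close>

lemma srep_mono: "srep k n \<Longrightarrow> k \<le> l \<Longrightarrow> srep l n"
  unfolding srep_def by (metis of_nat_mono order_trans)

lemma srep_0: "srep k 0"
  unfolding srep_def
  by (rule exI[of _ 0], rule exI[of _ "\<lambda>_. 0"]) (auto simp: supported_def weight_of_def)

lemma srep_uminus: "srep k n \<Longrightarrow> srep k (- n)"
  unfolding srep_def
proof (elim exE conjE)
  fix N e
  assume "supported N e" "value_of N e = n" "weight_of N e \<le> int k"
  then show "\<exists>N e. supported N e \<and> value_of N e = - n \<and> weight_of N e \<le> int k"
    by (intro exI[of _ N] exI[of _ "\<lambda>b. - e b"])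
      (auto simp: supported_def value_of_uminus weight_of_def)
qed

lemma srep_add:
  assumes "srep k n"
  shows "srep (Suc k) (n + int (mers b))"
proof (cases "b = 0")
  case True
  then show ?thesis using assms srep_mono[of k n "Suc k"] by simp
next
  case False
  from assms obtain N e where e: "supported N e" "value_of N e = n" "weight_of N e \<le> int k"
    unfolding srep_def by blast
  define M where "M = max N b"
  note ext = supported_extend[OF e(1), of M]
  show ?thesis unfolding srep_def
    by (rule exI[of _ M], rule exI[of _ "e(b := e b + 1)"])
      (use ext e False in \<open>auto simp: upd_simps M_def\<close>)
qed

lemma srep_diff:
  assumes "srep k n"
  shows "srep (Suc k) (n - int (mers b))"
  using srep_uminus[OF srep_add[OF srep_uminus[OF assms], of b]] by simp

lemma srep_sum: "finite A \<Longrightarrow> srep (card A) (\<Sum>v\<in>A. int (mers (h v)))"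
  proof (induction rule: finite_induct)
  case (insert x F)
  then show ?case
    using srep_add[OF insert.IH, of "h x"] by (simp add: add.commute)
qed (simp add: srep_0)

lemma srep_sum_diff:
  "finite B \<Longrightarrow> finite A \<Longrightarrow>
    srep (card A + card B) ((\<Sum>v\<in>A. int (mers (h v))) - (\<Sum>v\<in>B. int (mers (h v))))"
proof (induction rule: finite_induct)
  case (insert x F)
  from srep_diff[OF insert.IH[OF insert.prems], of "h x"] insert.hyps show ?case
    by (simp add: algebra_simps)
qed (simp add: srep_sum)

text \<open>In a normal form of \<open>n\<close> the leading term is \<open>mers d\<close> or
  \<open>mers (Suc d)\<close>; removing one copy of it lowers the weight by one. In the second case
  the remainder is nonpositive and its signs are flipped.\<close>

lemma srep_step:
  assumes "srep k (int n)" and d: "d \<ge> 1" "mers d \<le> n" "n \<le> mers (Suc d)"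
  shows "\<exists>j. k = Suc j \<and> (srep j (int (n - mers d)) \<or> srep j (int (mers (Suc d) - n)))"
proof -
  from assms(1) obtain N e where e: "supported N e" "normal e" "value_of N e = int n"
    "weight_of N e \<le> int k"
    unfolding srep_def by (metis normalise order_trans)
  have n: "n > 0" using mers_pos[OF d(1)] d(2) by simp
  obtain t where t: "Suc t \<le> N" "e (Suc t) \<ge> 1" "mers t < n" "n < mers (Suc (Suc t))"
    using normal_top[OF e(2), of N] e(3) n by auto
  have "mers t < mers (Suc d)" "mers d < mers (Suc (Suc t))"
    using t d by auto
  then have "t < Suc d" "d < Suc (Suc t)"
    by (simp_all add: mers_less_iff)
  then have td: "Suc t = d \<or> Suc t = Suc d" by auto
  have "weight_of N e = (\<Sum>b\<in>{1..N} - {Suc t}. \<bar>e b\<bar>) + \<bar>e (Suc t)\<bar>"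
    unfolding weight_of_def using t by (subst sum.remove[of _ "Suc t"]) auto
  moreover have "(\<Sum>b\<in>{1..N} - {Suc t}. \<bar>e b\<bar>) \<ge> 0" by (rule sum_nonneg) auto
  ultimately obtain j where j: "k = Suc j" using e(4) t(2) by (cases k) linarith+
  have "srep j (int n - int (mers (Suc t)))"
    unfolding srep_def
    by (rule exI[of _ N], rule exI[of _ "e(Suc t := e (Suc t) - 1)"])
      (use t e j in \<open>auto simp: upd_simps\<close>)
  then show ?thesis
    using td srep_uminus[of j "int n - int (mers (Suc t))"] j d by (auto simp: of_nat_diff)
qed

text \<open>The right-hand side is symmetric in the distances from \<open>n\<close> to the two
  neighbouring Mersenne numbers; this symmetry is what duality exploits.\<close>

lemma srep_iff:
  assumes "d \<ge> 1" "mers d \<le> n" "n \<le> mers (Suc d)"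
  shows "srep k (int n) \<longleftrightarrow>
    (\<exists>j. k = Suc j \<and> (srep j (int (n - mers d)) \<or> srep j (int (mers (Suc d) - n))))"
proof
  assume "\<exists>j. k = Suc j \<and> (srep j (int (n - mers d)) \<or> srep j (int (mers (Suc d) - n)))"
  then obtain j where j: "k = Suc j"
    and "srep j (int (n - mers d)) \<or> srep j (- int (mers (Suc d) - n))"
    using srep_uminus by blast
  from this(2) show "srep k (int n)"
  proof
    assume "srep j (int (n - mers d))"
    from srep_add[OF this, of d] show ?thesis using assms j by (simp add: of_nat_diff)
  next
    assume "srep j (- int (mers (Suc d) - n))"
    from srep_add[OF this, of "Suc d"] show ?thesis using assms j by (simp add: of_nat_diff)
  qed
qed (rule srep_step[OF _ assms])

subsection \<open>The greedy algorithm\<close>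

text \<open>\<open>floor_log (n + 1)\<close> is the largest \<open>d\<close> with
  \<open>mers d \<le> n\<close>, so this counts the terms of the greedy expansion.\<close>

function greedy :: "nat \<Rightarrow> nat" where
  "greedy n = (if n = 0 then 0 else Suc (greedy (n - mers (floor_log (n + 1)))))"
  by auto
termination
proof (relation "measure id")
  fix n :: nat
  assume "n \<noteq> 0"
  then have "mers (floor_log (n + 1)) \<ge> 1"
    using mers_pos[of "floor_log (n + 1)"] floor_log_le_iff[of 2 "n + 1"] floor_log_twice[of 1]
    by simp
  then show "(n - mers (floor_log (n + 1)), n) \<in> measure id"
    using \<open>n \<noteq> 0\<close> by simp
qed simp

declare greedy.simps [simp del]

lemma greedy_0 [simp]: "greedy 0 = 0"
  by (simp add: greedy.simps)

lemma greedy_step: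
  assumes "d \<ge> 1" "mers d \<le> n" "n < mers (Suc d)"
  shows "greedy n = Suc (greedy (n - mers d))"
proof -
  have "floor_log (n + 1) = d"
    using assms by (intro floor_log_eqI) (auto simp: mers_def)
  moreover have "n > 0" using mers_pos[OF assms(1)] assms(2) by simp
  ultimately show ?thesis by (subst greedy.simps) simp
qed

lemma greedy_mers: "d \<ge> 1 \<Longrightarrow> greedy (mers d) = 1"
  using greedy_step[of d "mers d"] by (simp add: mers_less)

text \<open>Unless \<open>y\<close> is a Mersenne number, \<open>y\<close> and \<open>y - 1\<close>
  share their first greedy term and induction applies. Otherwise \<open>mers (Suc m) - 1\<close> is
  two copies of \<open>mers m\<close>, so one term becomes two, or none if
  \<open>m = 0\<close>.\<close>

lemma greedy_pred: "greedy (y - 1) \<le> Suc (greedy y)"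
proof (induction y rule: less_induct)
  case (less y)
  show ?case
  proof (cases "y \<ge> 1")
    case True
    then obtain d where d: "d \<ge> 1" "mers d \<le> y" "y < mers (Suc d)"
      by (rule mers_interval)
    note gy = greedy_step[OF d]
    show ?thesis
    proof (cases "y = mers d")
      case True
      obtain m where m: "d = Suc m" using d(1) by (cases d) auto
      then have y: "y - 1 = 2 * mers m" using True by (simp add: mers_Suc)
      show ?thesis
      proof (cases "m = 0")
        case False
        then have "greedy (mers m + mers m) = Suc (greedy (mers m))"
          using greedy_step[of m "mers m + mers m"] by (simp add: mers_Suc)
        then have "greedy (y - 1) = Suc (greedy (mers m))"
          using y by (simp add: mult_2)
        with False gy True show ?thesis by (simp add: greedy_mers)
      qed (use y in simp)
    next
      case False
      then have "greedy (y - 1) = Suc (greedy (y - mers d - 1))"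
        using greedy_step[of d "y - 1"] d by (simp add: diff_right_commute)
      moreover have "y - mers d < y" using d mers_pos[of d] by simp
      ultimately show ?thesis using less.IH[of "y - mers d"] gy by simp
    qed
  qed simp
qed

text \<open>The exchange step for optimality of greedy expansions: taking away any single Mersenne
  number, not only the largest, saves at most one term.\<close>

lemma greedy_diff: "b \<ge> 1 \<Longrightarrow> mers b \<le> n \<Longrightarrow> greedy n \<le> Suc (greedy (n - mers b))"
proof (induction n arbitrary: b rule: less_induct)
  case (less n)
  have "n \<ge> 1" using mers_pos[of b] less.prems by simp
  then obtain d where d: "d \<ge> 1" "mers d \<le> n" "n < mers (Suc d)"
    by (rule mers_interval)
  note gn = greedy_step[OF d]
  have "mers b < mers (Suc d)" using d less.prems by linarith
  then have bd: "b \<le> d" by (simp add: mers_less_iff)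
  have smaller: "n - mers a < n" if "a \<ge> 1" for a
    using mers_pos[OF that] \<open>n \<ge> 1\<close> by simp
  consider "b = d" | "b < d" "n - mers b \<ge> mers d" | "b < d" "n - mers b < mers d"
    using bd by linarith
  then show ?case
  proof cases
    case 1
    then show ?thesis using gn by simp
  next
    case 2
    then have "greedy (n - mers b) = Suc (greedy (n - mers b - mers d))"
      using d by (intro greedy_step) auto
    moreover have "greedy (n - mers d) \<le> Suc (greedy (n - mers d - mers b))"
      using 2 less.prems d by (intro less.IH smaller) auto
    ultimately show ?thesis using gn by (simp add: add.commute)
  next
    \<comment> \<open>Here removing \<open>mers b\<close> drops below \<open>mers d\<close>, so the
      expansion of the rest starts with \<open>mers m\<close>, where
      \<open>m = d - 1\<close>.\<close>
    case 3
    then obtain m where m: "d = Suc m" "m \<ge> 1"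
      using less.prems(1) by (cases d) auto
    have "mers b \<le> mers m" using 3 m by (intro mers_mono) auto
    then have "n - mers b = n - mers b - mers m + mers m" "mers m \<le> n - mers b"
      using d m by (auto simp: mers_Suc)
    then have gb: "greedy (n - mers b) = Suc (greedy (n - mers b - mers m))"
      using 3 m by (intro greedy_step) auto
    \<comment> \<open>First the case \<open>b = m\<close>. If \<open>n - mers m\<close> falls below
      \<open>mers d\<close>, it equals \<open>mers m\<close> plus \<open>Suc (n - mers d)\<close>
      and \<open>greedy_pred\<close> compares the tails; otherwise both expansions start with
      \<open>mers d\<close>.\<close>
    have *: "greedy n \<le> Suc (greedy (n - mers m))"
    proof (cases "n - mers m < mers d")
      case True
      have "n - mers m = Suc (n - mers d) + mers m" using d m by (simp add: mers_Suc)
      moreover have "mers m \<le> n - mers m" using calculation by simp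
      ultimately have "greedy (n - mers m) = Suc (greedy (Suc (n - mers d)))"
        using greedy_step[of m "n - mers m"] True m by simp
      then show ?thesis using gn greedy_pred[of "Suc (n - mers d)"] by simp
    next
      case False
      then have "greedy (n - mers m) = Suc (greedy (n - mers m - mers d))"
        using d by (intro greedy_step) auto
      moreover have "mers m \<le> n - mers d"
        using False d m by (simp add: mers_Suc)
      then have "greedy (n - mers d) \<le> Suc (greedy (n - mers d - mers m))"
        using d m by (intro less.IH smaller) auto
      ultimately show ?thesis using gn by (simp add: add.commute)
    qed
    show ?thesis
    \<comment> \<open>For \<open>b < m\<close>, removing first \<open>mers m\<close> and then
      \<open>mers b\<close> costs at most two terms, and \<open>gb\<close> accounts for one of
      them.\<close>
    proof (cases "b = m")
      case False
      have "mers b \<le> n - mers m"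
        using \<open>mers b \<le> mers m\<close> d m by (simp add: mers_Suc)
      then have "greedy (n - mers m) \<le> Suc (greedy (n - mers m - mers b))"
        using less.prems m by (intro less.IH smaller) auto
      with * gb show ?thesis by (simp add: add.commute)
    qed (use * in simp)
  qed
qed

lemma greedy_add: "greedy (n + mers b) \<le> Suc (greedy n)"
  using greedy_diff[of b "n + mers b"] by (cases "b = 0") auto

text \<open>Optimality of the greedy expansion among positive sums, used with \<open>A\<close> a set
  of lower ends of boundary edges.\<close>

lemma greedy_sum: "finite A \<Longrightarrow> greedy (\<Sum>v\<in>A. mers (h v)) \<le> card A"
proof (induction rule: finite_induct)
  case (insert x F)
  then show ?case
    using greedy_add[of "\<Sum>v\<in>F. mers (h v)" "h x"] by (simp add: add.commute)
qed simp

text \<open>Used to show that cutting \<open>n\<close> vertices out of a larger complete subtree is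
  never cheaper. For \<open>n > 0\<close>, \<open>mers (Suc b) - n\<close> starts with
  \<open>mers b\<close> and leaves \<open>Suc (mers b - n)\<close>, which \<open>greedy_pred\<close>
  compares with \<open>mers b - n\<close>.\<close>

lemma greedy_mers_diff:
  assumes "n \<le> mers a" "a \<le> b"
  shows "greedy (mers a - n) \<le> greedy (mers b - n)"
  using assms(2)
proof (induction b rule: dec_induct)
  case (step b)
  have n: "n \<le> mers b" using assms(1) mers_mono[OF step.hyps(1)] by simp
  show ?case
  proof (cases "n = 0")
    case True
    then show ?thesis using assms step by (cases "a = 0") (auto simp: greedy_mers)
  next
    case False
    then have b: "b \<ge> 1" using n by (cases b) auto
    have *: "mers (Suc b) - n - mers b = Suc (mers b - n)"
      using n by (simp add: mers_Suc)
    have "greedy (mers (Suc b) - n) = Suc (greedy (Suc (mers b - n)))"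
      unfolding *[symmetric] using b False n by (intro greedy_step) (auto simp: mers_Suc)
    then show ?thesis
      using step.IH greedy_pred[of "Suc (mers b - n)"] by simp
  qed
qed simp

subsection \<open>Edge boundaries in the tree\<close>

lemma pverts_T_inf: "pverts T_inf = {v. fst v \<ge> 1}"
  by (auto simp: T_inf_def)

lemma parcs_T_inf:
  "(u, v) \<in> parcs T_inf \<longleftrightarrow> fst u \<ge> 1 \<and> v = parent u \<or> fst v \<ge> 1 \<and> u = parent v"
  by (cases u; cases v) (auto simp: T_inf_def)

lemma fst_parent [simp]: "fst (parent v) = Suc (fst v)"
  by (simp add: parent_def)

text \<open>An edge is identified with its lower end.\<close>

definition boundary :: "(nat \<times> nat) set \<Rightarrow> (nat \<times> nat) set" where
  "boundary S = {v. fst v \<ge> 1 \<and> (v \<in> S \<longleftrightarrow> parent v \<notin> S)}"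

lemma cut_eq_boundary:
  assumes "S \<subseteq> pverts T_inf"
  shows "cut S = (\<lambda>v. {v, parent v}) ` boundary S"
proof
  show "cut S \<subseteq> (\<lambda>v. {v, parent v}) ` boundary S"
  proof
    fix x
    assume "x \<in> cut S"
    then obtain u v where x: "x = {u, v}" and "(u, v) \<in> parcs T_inf" "u \<in> S" "v \<notin> S"
      by (auto simp: cut_def)
    then consider "v = parent u" "u \<in> boundary S" | "u = parent v" "v \<in> boundary S"
      by (auto simp: parcs_T_inf boundary_def)
    then show "x \<in> (\<lambda>v. {v, parent v}) ` boundary S"
      by cases (auto simp: x)
  qed
  show "(\<lambda>v. {v, parent v}) ` boundary S \<subseteq> cut S"
  proof
    fix x
    assume "x \<in> (\<lambda>v. {v, parent v}) ` boundary S"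
    then obtain v where v: "x = {v, parent v}" "fst v \<ge> 1" "v \<in> S \<longleftrightarrow> parent v \<notin> S"
      by (auto simp: boundary_def)
    show "x \<in> cut S"
    proof (cases "v \<in> S")
      case True
      then show ?thesis using v unfolding cut_def
        by (intro CollectI exI[of _ v] exI[of _ "parent v"])
          (auto simp: parcs_T_inf pverts_T_inf)
    next
      case False
      then show ?thesis using v unfolding cut_def
        by (intro CollectI exI[of _ "parent v"] exI[of _ v])
          (auto simp: parcs_T_inf pverts_T_inf)
    qed
  qed
qed

text \<open>\<open>parent\<close> raises the level, so an edge determines its lower end.\<close>

lemma card_cut:
  assumes "S \<subseteq> pverts T_inf"
  shows "card (cut S) = card (boundary S)"
proof -
  have "inj_on (\<lambda>v. {v, parent v}) (boundary S)"
  proof (rule inj_onI)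
    fix v w
    assume eq: "{v, parent v} = {w, parent w}"
    have False if "v = parent w" "parent v = w"
      using arg_cong[OF that(1), of fst] arg_cong[OF that(2), of fst] by simp
    then show "v = w" using eq by (auto simp: doubleton_eq_iff)
  qed
  then show ?thesis
    using assms by (simp add: cut_eq_boundary card_image)
qed

text \<open>For a leaf this contains two pairs on level 0, which are not vertices; they do no harm
  in the sums below because \<open>mers 0 = 0\<close>.\<close>

definition children :: "(nat \<times> nat) set \<Rightarrow> (nat \<times> nat) set" where
  "children S = {v. parent v \<in> S}"

lemma children_eq:
  assumes "\<And>v. v \<in> S \<Longrightarrow> fst v \<ge> 1"
  shows "children S = (\<lambda>v. (fst v - 1, 2 * snd v)) ` S \<union> (\<lambda>v. (fst v - 1, 2 * snd v + 1)) ` S"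
    (is "_ = ?f ` S \<union> ?g ` S")
proof
  show "children S \<subseteq> ?f ` S \<union> ?g ` S"
  proof
    fix v
    assume "v \<in> children S"
    then have "parent v \<in> S" by (simp add: children_def)
    moreover have "v = ?f (parent v) \<or> v = ?g (parent v)"
      by (cases v) (auto simp: parent_def)
    ultimately show "v \<in> ?f ` S \<union> ?g ` S" by blast
  qed
  show "?f ` S \<union> ?g ` S \<subseteq> children S"
    using assms by (fastforce simp: children_def parent_def)
qed

lemma finite_children:
  assumes "finite S" "\<And>v. v \<in> S \<Longrightarrow> fst v \<ge> 1"
  shows "finite (children S)"
  using assms by (simp add: children_eq)

text \<open>The recursion \<open>mers_Suc\<close> summed over \<open>S\<close>: each vertex weighs
  one more than its two children together.\<close>

lemma sum_children:
  assumes "finite S" "\<And>v. v \<in> S \<Longrightarrow> fst v \<ge> 1"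
  shows "(\<Sum>v\<in>children S. mers (fst v)) + card S = (\<Sum>v\<in>S. mers (fst v))"
proof -
  let ?f = "\<lambda>v::nat \<times> nat. (fst v - 1, 2 * snd v)"
  let ?g = "\<lambda>v::nat \<times> nat. (fst v - 1, 2 * snd v + 1)"
  have inj: "inj_on ?f S" "inj_on ?g S"
    using assms(2) by (auto intro!: inj_onI) (metis Suc_le_eq Suc_pred fst_conv)+
  have disj: "?f ` S \<inter> ?g ` S = {}"
  proof -
    have "2 * a \<noteq> 2 * b + 1" for a b :: nat by presburger
    then show ?thesis by auto
  qed
  have "(\<Sum>v\<in>children S. mers (fst v)) = (\<Sum>v\<in>S. mers (fst v - 1)) + (\<Sum>v\<in>S. mers (fst v - 1))"
    using assms disj inj by (simp add: children_eq sum.union_disjoint sum.reindex)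
  then have "(\<Sum>v\<in>children S. mers (fst v)) + card S = (\<Sum>v\<in>S. 2 * mers (fst v - 1) + 1)"
    by (simp only: sum.distrib card_eq_sum mult_2)
  also have "\<dots> = (\<Sum>v\<in>S. mers (fst v))"
    using assms(2) 
  proof (intro sum.cong refl)
    fix v
    assume "v \<in> S"
    then have "fst v = Suc (fst v - 1)" using assms(2) by fastforce
    then show "2 * mers (fst v - 1) + 1 = mers (fst v)" using mers_Suc[of "fst v - 1"] by simp
  qed
  finally show ?thesis .
qed

definition upper_boundary :: "(nat \<times> nat) set \<Rightarrow> (nat \<times> nat) set" where
  "upper_boundary S = {v \<in> S. parent v \<notin> S}"

definition lower_boundary :: "(nat \<times> nat) set \<Rightarrow> (nat \<times> nat) set" where
  "lower_boundary S = {v. fst v \<ge> 1 \<and> v \<notin> S \<and> parent v \<in> S}"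

lemma boundary_split:
  assumes "finite S" "S \<subseteq> pverts T_inf"
  shows "finite (upper_boundary S)" "finite (lower_boundary S)" "finite (boundary S)"
    "card (boundary S) = card (upper_boundary S) + card (lower_boundary S)"
proof -
  have S: "fst v \<ge> 1" if "v \<in> S" for v
    using assms(2) that by (auto simp: pverts_T_inf)
  show u: "finite (upper_boundary S)"
    using assms(1) by (simp add: upper_boundary_def)
  show l: "finite (lower_boundary S)"
    by (rule finite_subset[OF _ finite_children[OF assms(1) S]])
      (auto simp: lower_boundary_def children_def)
  have *: "boundary S = upper_boundary S \<union> lower_boundary S"
    using S by (auto simp: boundary_def upper_boundary_def lower_boundary_def)
  then show "finite (boundary S)" using u l by simp
  show "card (boundary S) = card (upper_boundary S) + card (lower_boundary S)"
    unfolding * using u l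
    by (intro card_Un_disjoint) (auto simp: upper_boundary_def lower_boundary_def)
qed

text \<open>Telescoping: in \<open>sum_children\<close> the vertices of \<open>S\<close> whose
  parent is also in \<open>S\<close> occur on both sides and cancel, leaving only ends of boundary
  edges.\<close>

lemma card_eq_boundary_sums:
  assumes "finite S" "S \<subseteq> pverts T_inf"
  shows "card S + (\<Sum>v\<in>lower_boundary S. mers (fst v)) = (\<Sum>v\<in>upper_boundary S. mers (fst v))"
proof -
  have S: "fst v \<ge> 1" if "v \<in> S" for v
    using assms(2) that by (auto simp: pverts_T_inf)
  note fin = finite_children[OF assms(1) S]
  have "(\<Sum>v\<in>S. mers (fst v)) =
      (\<Sum>v\<in>S \<inter> children S. mers (fst v)) + (\<Sum>v\<in>S - children S. mers (fst v))"
    using assms(1) by (rule sum.Int_Diff)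
  moreover have "(\<Sum>v\<in>children S. mers (fst v)) =
      (\<Sum>v\<in>children S \<inter> S. mers (fst v)) + (\<Sum>v\<in>children S - S. mers (fst v))"
    using fin by (rule sum.Int_Diff)
  moreover have "S - children S = upper_boundary S"
    by (auto simp: upper_boundary_def children_def)
  moreover have "(\<Sum>v\<in>children S - S. mers (fst v)) = (\<Sum>v\<in>lower_boundary S. mers (fst v))"
  \<comment> \<open>The two index sets differ only in pairs on level 0, of weight
    \<open>mers 0 = 0\<close>.\<close>
  proof (rule sum.mono_neutral_right)
    show "\<forall>v\<in>(children S - S) - lower_boundary S. mers (fst v) = 0"
    proof
      fix v
      assume "v \<in> (children S - S) - lower_boundary S"
      then have "fst v = 0" by (auto simp: lower_boundary_def children_def)
      then show "mers (fst v) = 0" by simp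
    qed
  qed (use fin in \<open>auto simp: lower_boundary_def children_def\<close>)
  ultimately show ?thesis
    using sum_children[OF assms(1) S] by (simp add: Int_commute)
qed

subsection \<open>Complete subtrees\<close>

text \<open>The complete subtree rooted at \<open>(d, j)\<close>: the ancestor of \<open>v\<close>
  on level \<open>d\<close> has position \<open>snd v div 2 ^ (d - fst v)\<close>.\<close>

definition below :: "nat \<Rightarrow> nat \<Rightarrow> (nat \<times> nat) set" where
  "below d j = {v. 1 \<le> fst v \<and> fst v \<le> d \<and> snd v div 2 ^ (d - fst v) = j}"

lemma below_0 [simp]: "below 0 j = {}"
  by (auto simp: below_def)

lemma below_subset: "below d j \<subseteq> pverts T_inf"
  by (auto simp: below_def pverts_T_inf)

lemma parent_in_below_iff:
  assumes "fst v \<ge> 1"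
  shows "parent v \<in> below d j \<longleftrightarrow> v \<in> below d j \<and> v \<noteq> (d, j)"
proof (cases "fst v < d")
  case True
  then obtain k where "d - fst v = Suc k" "d - Suc (fst v) = k"
    by (metis Suc_diff_Suc)
  moreover have "v \<noteq> (d, j)" using True by auto
  ultimately show ?thesis
    using assms True by (auto simp: below_def parent_def div_mult2_eq)
next
  case False
  then show ?thesis
    by (cases v) (auto simp: below_def parent_def)
qed

lemma below_Suc: "below (Suc d) j = insert (Suc d, j) (below d (2 * j) \<union> below d (2 * j + 1))"
proof (rule set_eqI)
  fix v :: "nat \<times> nat"
  show "v \<in> below (Suc d) j \<longleftrightarrow> v \<in> insert (Suc d, j) (below d (2 * j) \<union> below d (2 * j + 1))"
  proof (cases "fst v \<le> d")
    case True
    then have "snd v div 2 ^ (Suc d - fst v) = snd v div 2 ^ (d - fst v) div 2"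
      by (simp add: Suc_diff_le flip: div_mult2_eq) (simp add: mult.commute)
    moreover have "x div 2 = j \<longleftrightarrow> x = 2 * j \<or> x = 2 * j + 1" for x :: nat
      by linarith
    ultimately have "snd v div 2 ^ (Suc d - fst v) = j \<longleftrightarrow>
        snd v div 2 ^ (d - fst v) = 2 * j \<or> snd v div 2 ^ (d - fst v) = 2 * j + 1"
      by simp
    then show ?thesis
      using True unfolding below_def by (cases v) (simp, blast)
  qed (cases v; auto simp: below_def)
qed

lemma root_notin_below: "(Suc d, j) \<notin> below d l"
  by (simp add: below_def)

lemma below_disjoint: "a \<noteq> b \<Longrightarrow> below d a \<inter> below d b = {}"
  by (auto simp: below_def)

lemma finite_card_below: "finite (below d j) \<and> card (below d j) = mers d"
proof (induction d arbitrary: j)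
  case (Suc d)
  have "card (below d (2 * j) \<union> below d (2 * j + 1)) = mers d + mers d"
    using Suc.IH by (subst card_Un_disjoint) (auto simp: below_disjoint)
  then show ?case
    using Suc.IH by (simp add: below_Suc root_notin_below mers_Suc)
qed simp

lemmas finite_below [simp] = finite_card_below[THEN conjunct1]
lemmas card_below [simp] = finite_card_below[THEN conjunct2]

lemma boundary_below: "boundary (below d j) \<subseteq> {(d, j)}"
  by (auto simp: boundary_def parent_in_below_iff)

lemma finite_boundary: "S \<subseteq> below d j \<Longrightarrow> finite (boundary S)"
  using boundary_split(3)[of S] finite_subset[of S "below d j"] below_subset[of d j] by auto

lemma card_boundary_insert:
  assumes "S \<subseteq> below d l" "card (boundary S) \<le> k" "boundary T \<subseteq> insert v (boundary S)"
  shows "card (boundary T) \<le> Suc k"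
proof -
  have "card (boundary T) \<le> card (insert v (boundary S))"
    using assms(3) finite_boundary[OF assms(1)] by (intro card_mono) auto
  also have "\<dots> \<le> Suc k"
    using assms(2) card_insert_le_m1[of "Suc k" "boundary S"] by simp
  finally show ?thesis .
qed

text \<open>Apart from the root, a vertex and its parent are both inside or both outside a complete
  subtree, so only the edge above its root can be new. The same holds for the difference
  below.\<close>

lemma card_boundary_Un_below:
  assumes "S \<subseteq> below d l" "card (boundary S) \<le> k"
  shows "card (boundary (below e j \<union> S)) \<le> Suc k"
  by (rule card_boundary_insert[OF assms, of _ "(e, j)"])
    (use boundary_below[of e j] in \<open>auto simp: boundary_def\<close>)

lemma card_boundary_below_Diff:
  assumes "S \<subseteq> below d l" "card (boundary S) \<le> k"
  shows "card (boundary (below e j - S)) \<le> Suc k"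
  by (rule card_boundary_insert[OF assms, of _ "(e, j)"])
    (use boundary_below[of e j] in \<open>auto simp: boundary_def\<close>)

lemma card_boundary_below: "card (boundary (below d j)) \<le> 1"
  using card_mono[OF _ boundary_below[of d j]] by simp

text \<open>The construction follows \<open>srep_step\<close>: either fill one child subtree and
  continue in the other, or remove a set inside one child subtree from the full tree. Either
  remainder is at most \<open>mers d\<close> and fits.\<close>

lemma exists_set_srep:
  assumes "srep k (int n)" "n \<le> mers d"
  shows "\<exists>S\<subseteq>below d j. card S = n \<and> card (boundary S) \<le> k"
  using assms
proof (induction d arbitrary: n j k)
  case 0
  then show ?case by (intro exI[of _ "{}"]) (auto simp: boundary_def)
next
  case (Suc d)
  have sub: "below d (2 * j) \<subseteq> below (Suc d) j" "below d (2 * j + 1) \<subseteq> below (Suc d) j"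
    by (auto simp: below_Suc)
  consider "n \<le> mers d" | "n = mers (Suc d)" | "mers d < n" "n < mers (Suc d)"
    using Suc.prems by linarith
  then show ?case
  proof cases
    case 1
    then show ?thesis using Suc.IH[OF Suc.prems(1), of "2 * j"] sub by blast
  next
    case 2
    \<comment> \<open>A positive value needs at least one term, which pays for the single boundary
      edge of the full subtree.\<close>
    then have "k \<noteq> 0"
      using Suc.prems srep_step[of k n "Suc d"] mers_mono[of "Suc d" "Suc (Suc d)"] by auto
    then have "card (boundary (below (Suc d) j)) \<le> k"
      using card_boundary_below[of "Suc d" j] by linarith
    then show ?thesis using 2 card_below by blast
  next
    case 3
    then have "d \<ge> 1" by (cases d) auto
    then obtain i where k: "k = Suc i"
      and "srep i (int (n - mers d)) \<or> srep i (int (mers (Suc d) - n))"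
      using srep_step[OF Suc.prems(1), of d] 3 by auto
    from this(2) show ?thesis
    proof
      assume "srep i (int (n - mers d))"
      then obtain S where S: "S \<subseteq> below d (2 * j + 1)" "card S = n - mers d"
        "card (boundary S) \<le> i"
        using Suc.IH[of i "n - mers d" "2 * j + 1"] 3 unfolding mers_Suc by force
      have "finite S" using S(1) by (rule finite_subset) simp
      moreover have "below d (2 * j) \<inter> S = {}"
        using S(1) below_disjoint[of "2 * j" "2 * j + 1" d] by auto
      ultimately have "card (below d (2 * j) \<union> S) = n"
        using S(2) 3 by (subst card_Un_disjoint) auto
      then show ?thesis
        using card_boundary_Un_below[OF S(1,3), of d "2 * j"] k S(1) sub
        by (intro exI[of _ "below d (2 * j) \<union> S"]) auto
    next
      assume "srep i (int (mers (Suc d) - n))"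
      then obtain S where S: "S \<subseteq> below d (2 * j)" "card S = mers (Suc d) - n"
        "card (boundary S) \<le> i"
        using Suc.IH[of i "mers (Suc d) - n" "2 * j"] 3 unfolding mers_Suc by force
      have "finite S" using S(1) by (rule finite_subset) simp
      then have "card (below (Suc d) j - S) = n"
        using S sub 3 by (subst card_Diff_subset) auto
      then show ?thesis
        using card_boundary_below_Diff[OF S(1,3), of "Suc d" j] k
        by (intro exI[of _ "below (Suc d) j - S"]) auto
    qed
  qed
qed

definition down_closed :: "(nat \<times> nat) set \<Rightarrow> bool" where
  "down_closed S \<longleftrightarrow> (\<forall>v. fst v \<ge> 1 \<longrightarrow> parent v \<in> S \<longrightarrow> v \<in> S)"

lemma down_closed_below: "down_closed (below d j)"
  by (auto simp: down_closed_def parent_in_below_iff)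

text \<open>The same recursion using only unions of complete subtrees, which keeps the set closed
  under descendants.\<close>

lemma exists_set_greedy:
  assumes "n \<le> mers d"
  shows "\<exists>S\<subseteq>below d j. card S = n \<and> down_closed S \<and> card (boundary S) \<le> greedy n"
  using assms
proof (induction d arbitrary: n j)
  case 0
  then show ?case by (intro exI[of _ "{}"]) (auto simp: boundary_def down_closed_def)
next
  case (Suc d)
  have sub: "below d (2 * j) \<subseteq> below (Suc d) j" "below d (2 * j + 1) \<subseteq> below (Suc d) j"
    by (auto simp: below_Suc)
  consider "n \<le> mers d" | "n = mers (Suc d)" | "mers d < n" "n < mers (Suc d)"
    using Suc.prems by linarith
  then show ?case
  proof cases
    case 1
    then show ?thesis using Suc.IH[OF 1, of "2 * j"] sub by blast
  next
    case 2
    then have "card (boundary (below (Suc d) j)) \<le> greedy n"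
      using card_boundary_below[of "Suc d" j] by (simp add: greedy_mers)
    then show ?thesis using 2 card_below down_closed_below by blast
  next
    case 3
    then have "d \<ge> 1" by (cases d) auto
    then have g: "greedy n = Suc (greedy (n - mers d))"
      using 3 by (intro greedy_step) auto
    obtain S where S: "S \<subseteq> below d (2 * j + 1)" "card S = n - mers d" "down_closed S"
      "card (boundary S) \<le> greedy (n - mers d)"
      using Suc.IH[of "n - mers d" "2 * j + 1"] 3 unfolding mers_Suc by force
    have "finite S" using S(1) by (rule finite_subset) simp
    moreover have "below d (2 * j) \<inter> S = {}"
      using S(1) below_disjoint[of "2 * j" "2 * j + 1" d] by auto
    ultimately have "card (below d (2 * j) \<union> S) = n"
      using S(2) 3 by (subst card_Un_disjoint) auto
    moreover have "down_closed (below d (2 * j) \<union> S)"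
      using S(3) down_closed_below[of d "2 * j"] by (auto simp: down_closed_def)
    ultimately show ?thesis
      using card_boundary_Un_below[OF S(1,4), of d "2 * j"] g S(1) sub
      by (intro exI[of _ "below d (2 * j) \<union> S"]) auto
  qed
qed

subsection \<open>Connectivity\<close>

definition adj :: "(nat \<times> nat) set \<Rightarrow> ((nat \<times> nat) \<times> (nat \<times> nat)) set" where
  "adj U = {(u, v). u \<in> U \<and> v \<in> U \<and> (u, v) \<in> parcs T_inf}"

lemma sym_adj: "sym (adj U)"
  by (auto simp: sym_def adj_def parcs_T_inf)

lemma parcs_induced: "parcs (mk_symmetric (with_proj T_inf \<restriction> U)) = adj U"
  using sym_adj[of U] by (auto simp: parcs_mk_symmetric adj_def sym_def)

lemma rtrancl_on_adj:
  assumes "u \<in> U"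
  shows "(u, v) \<in> rtrancl_on U (adj U) \<longleftrightarrow> (u, v) \<in> (adj U)\<^sup>*"
proof
  assume "(u, v) \<in> (adj U)\<^sup>*"
  then show "(u, v) \<in> rtrancl_on U (adj U)"
  proof induction
    case (step y z)
    from step.IH step.hyps(2) show ?case
      by (rule rtrancl_on_into_rtrancl_on) (use step.hyps(2) in \<open>simp add: adj_def\<close>)
  qed (use assms in simp)
qed (rule rtrancl_on_rtranclI)

lemma induces_connected_iff:
  "induces_connected U \<longleftrightarrow> U \<noteq> {} \<and> (\<forall>u\<in>U. \<forall>v\<in>U. (u, v) \<in> (adj U)\<^sup>*)"
  unfolding induces_connected_def connected_def strongly_connected_def reachable_def
  by (simp add: parcs_induced rtrancl_on_adj)

text \<open>A path inside \<open>U\<close> starting at \<open>v\<close> could leave the subtree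
  below \<open>v\<close> only through \<open>parent v\<close>, which is not in
  \<open>U\<close>.\<close>

lemma connected_within_below:
  assumes U: "U \<subseteq> pverts T_inf" "induces_connected U"
    and v: "v \<in> U" "parent v \<notin> U"
  shows "U \<subseteq> below (fst v) (snd v)"
proof
  fix w
  assume "w \<in> U"
  then have "(v, w) \<in> (adj U)\<^sup>*"
    using U(2) v(1) by (auto simp: induces_connected_iff)
  then show "w \<in> below (fst v) (snd v)"
  proof induction
    case base
    then show ?case using U(1) v(1) by (auto simp: below_def pverts_T_inf)
  next
    case (step y z)
    then have "y \<in> U" "z \<in> U" and e: "(y, z) \<in> parcs T_inf" by (auto simp: adj_def)
    then have "y \<noteq> v \<or> z \<noteq> parent v" using v(2) by auto
    moreover have "fst y \<ge> 1" "fst z \<ge> 1"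
      using U(1) \<open>y \<in> U\<close> \<open>z \<in> U\<close> by (auto simp: pverts_T_inf)
    ultimately show ?case
      using e step.IH parent_in_below_iff[of y "fst v" "snd v"]
        parent_in_below_iff[of z "fst v" "snd v"]
      by (auto simp: parcs_T_inf)
  qed
qed

lemma infinite_pverts: "infinite (pverts T_inf)"
proof
  assume "finite (pverts T_inf)"
  moreover have "(\<lambda>i. (1, i)) ` UNIV \<subseteq> pverts T_inf"
    by (auto simp: pverts_T_inf)
  ultimately have "finite ((\<lambda>i::nat. (1::nat, i)) ` UNIV)"
    by (rule finite_subset[rotated])
  then show False
    using finite_imageD[of "\<lambda>i::nat. (1::nat, i)" UNIV] by (auto intro: inj_onI)
qed

text \<open>A vertex outside \<open>S\<close> with its parent in \<open>S\<close> would confine the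
  connected complement to the finite subtree below it, but the complement is infinite.\<close>

lemma lower_boundary_empty:
  assumes "finite S" "induces_connected (pverts T_inf - S)"
  shows "lower_boundary S = {}"
proof (rule equals0I)
  fix v
  assume "v \<in> lower_boundary S"
  then have "v \<in> pverts T_inf - S" "parent v \<notin> pverts T_inf - S"
    by (auto simp: lower_boundary_def pverts_T_inf)
  then have "pverts T_inf - S \<subseteq> below (fst v) (snd v)"
    using assms(2) by (intro connected_within_below) auto
  then have "finite (pverts T_inf - S)"
    by (rule finite_subset) simp
  then show False
    using infinite_pverts assms(1) by simp
qed

text \<open>Each of the two vertices lies in the complete subtree below the other, so their levels
  and then their positions agree.\<close>

lemma upper_boundary_unique:
  assumes S: "S \<subseteq> pverts T_inf" "induces_connected S"
    and vw: "v \<in> upper_boundary S" "w \<in> upper_boundary S"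
  shows "v = w"
proof -
  have "v \<in> below (fst w) (snd w)" "w \<in> below (fst v) (snd v)"
    using connected_within_below[OF S, of v] connected_within_below[OF S, of w] vw
    by (auto simp: upper_boundary_def)
  then show ?thesis by (auto simp: below_def intro: prod_eqI)
qed

lemma adj_parent: "v \<in> U \<Longrightarrow> parent v \<in> U \<Longrightarrow> U \<subseteq> pverts T_inf \<Longrightarrow> (v, parent v) \<in> adj U"
  by (auto simp: adj_def parcs_T_inf pverts_T_inf)

lemma rtrancl_adj_sym: "(u, v) \<in> (adj U)\<^sup>* \<Longrightarrow> (v, u) \<in> (adj U)\<^sup>*"
  using sym_rtrancl[OF sym_adj, of U] by (rule symD)

lemma connected_if_rooted:
  assumes U: "U \<subseteq> below d j" "(d, j) \<in> U"
    and up: "\<And>v. v \<in> U \<Longrightarrow> v \<noteq> (d, j) \<Longrightarrow> parent v \<in> U"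
  shows "induces_connected U"
proof -
  have U': "U \<subseteq> pverts T_inf" using U(1) below_subset[of d j] by simp
  have *: "(v, (d, j)) \<in> (adj U)\<^sup>*" if "v \<in> U" for v
    using that
  proof (induction "d - fst v" arbitrary: v rule: less_induct)
    case less
    show ?case
    proof (cases "v = (d, j)")
      case False
      then have p: "parent v \<in> U" using less.prems up by blast
      \<comment> \<open>This bound makes \<open>d - fst v\<close> drop strictly on passing to the
        parent.\<close>
      then have "fst (parent v) \<le> d" using U(1) by (auto simp: below_def)
      then have "(parent v, (d, j)) \<in> (adj U)\<^sup>*"
        using less.hyps[of "parent v"] p by simp
      then show ?thesis
        using adj_parent[OF less.prems p U'] by (rule converse_rtrancl_into_rtrancl[rotated])
    qed simp
  qed
  show ?thesis
    unfolding induces_connected_iff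
    using U(2) * by (metis empty_iff rtrancl_adj_sym rtrancl_trans)
qed

text \<open>The complement is closed under parents, and any two vertices have a common ancestor high
  enough in the tree.\<close>

lemma connected_compl_down_closed:
  assumes "finite S" "down_closed S"
  shows "induces_connected (pverts T_inf - S)"
proof -
  let ?U = "pverts T_inf - S"
  have up: "parent v \<in> ?U" if "v \<in> ?U" for v
    using that assms(2) unfolding down_closed_def pverts_T_inf by (intro DiffI) (simp, blast)
  have *: "((i, l), (i + k, l div 2 ^ k)) \<in> (adj ?U)\<^sup>* \<and> (i + k, l div 2 ^ k) \<in> ?U"
    if "(i, l) \<in> ?U" for i l k
  proof (induction k)
    case (Suc k)
    let ?v = "(i + k, l div 2 ^ k)"
    have p: "parent ?v = (i + Suc k, l div 2 ^ Suc k)"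
      by (simp add: parent_def div_mult2_eq mult.commute flip: div_mult2_eq)
    have "(?v, parent ?v) \<in> adj ?U"
      using Suc.IH up[of ?v] by (intro adj_parent) auto
    then show ?case
      using Suc.IH up[of ?v] unfolding p by (auto intro: rtrancl_into_rtrancl)
  qed (use that in simp)
  have "(u, v) \<in> (adj ?U)\<^sup>*" if "u \<in> ?U" "v \<in> ?U" for u v
  proof -
    obtain i l i' l' where uv: "u = (i, l)" "v = (i', l')" by (cases u, cases v)
    \<comment> \<open>Both climbs end on level \<open>i + i' + l + l'\<close>; each is at least as
      long as its starting position, so both positions have become 0 there.\<close>
    have z: "a div 2 ^ (b + a) = 0" for a b :: nat
      by (rule div_less, rule less_le_trans[OF less_exp]) (simp add: power_increasing)
    have "(u, (i + ((i' + l') + l), l div 2 ^ ((i' + l') + l))) \<in> (adj ?U)\<^sup>*"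
      using *[of i l "(i' + l') + l"] that uv by blast
    moreover have "(v, (i' + ((i + l) + l'), l' div 2 ^ ((i + l) + l'))) \<in> (adj ?U)\<^sup>*"
      using *[of i' l' "(i + l) + l'"] that uv by blast
    moreover have "i' + ((i + l) + l') = i + ((i' + l') + l)" by simp
    ultimately show ?thesis
      unfolding z by (metis rtrancl_adj_sym rtrancl_trans)
  qed
  moreover have "?U \<noteq> {}"
    using infinite_pverts assms(1) by (metis finite.emptyI finite_Diff2)
  ultimately show ?thesis
    by (auto simp: induces_connected_iff)
qed

subsection \<open>The three minima\<close>

lemma Inf_nat_eqI:
  fixes A B :: "nat set"
  assumes "\<And>a. a \<in> A \<Longrightarrow> \<exists>b\<in>B. b \<le> a" "\<And>b. b \<in> B \<Longrightarrow> \<exists>a\<in>A. a \<le> b"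
  shows "Inf A = Inf B"
proof (cases "A = {}")
  case True
  then have "B = {}" using assms(2) by auto
  with True show ?thesis by simp
next
  case False
  then have "B \<noteq> {}" using assms(1) by auto
  with False show ?thesis
    using assms by (intro antisym cInf_mono) auto
qed

lemma vertex_sets_below: "S \<subseteq> below d j \<Longrightarrow> card S = n \<Longrightarrow> S \<in> vertex_sets n"
  using finite_subset[of S "below d j"] below_subset[of d j] by (auto simp: vertex_sets_def)

text \<open>Guarantees that the subtree rooted at \<open>(n, 0)\<close> has room for
  \<open>n\<close> vertices.\<close>

lemma le_mers: "n \<le> mers n"
  by (induction n) (auto simp: mers_Suc)

lemma delta_eq: "delta n = Inf {k. srep k (int n)}"
  unfolding delta_def
proof (rule Inf_nat_eqI)
  fix a
  assume "a \<in> {card (cut S) |S. S \<in> vertex_sets n}"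
  then obtain S where S: "S \<subseteq> pverts T_inf" "finite S" "card S = n" "a = card (cut S)"
    by (auto simp: vertex_sets_def)
  note bs = boundary_split[OF S(2,1)]
  have "int n = (\<Sum>v\<in>upper_boundary S. int (mers (fst v))) - (\<Sum>v\<in>lower_boundary S. int (mers (fst v)))"
    using card_eq_boundary_sums[OF S(2,1), THEN arg_cong, of int] S(3) by simp
  then have "srep a (int n)"
    using srep_sum_diff[OF bs(2,1), of fst] bs(4) S card_cut by simp
  then show "\<exists>b\<in>{k. srep k (int n)}. b \<le> a" by auto
next
  fix k
  assume "k \<in> {k. srep k (int n)}"
  then obtain S where "S \<subseteq> below n 0" "card S = n" "card (boundary S) \<le> k"
    using exists_set_srep[of k n n 0] le_mers by auto
  moreover from this have "card (cut S) = card (boundary S)"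
    using below_subset[of n 0] by (intro card_cut) auto
  ultimately show "\<exists>a\<in>{card (cut S) |S. S \<in> vertex_sets n}. a \<le> k"
    using vertex_sets_below[of S n 0 n] by auto
qed

text \<open>Without lower boundary, \<open>n\<close> is a positive sum with one term per cut edge,
  so \<open>greedy_sum\<close> bounds the cut; down-closed sets attain the bound.\<close>

lemma delta_P_eq: "delta_P n = greedy n"
  unfolding delta_P_def
proof (rule antisym)
  let ?A = "{card (cut S) |S. S \<in> vertex_sets n \<and> induces_connected (pverts T_inf - S)}"
  obtain S where S: "S \<subseteq> below n 0" "card S = n" "down_closed S" "card (boundary S) \<le> greedy n"
    using exists_set_greedy[of n n 0] le_mers by auto
  then have "finite S" "S \<subseteq> pverts T_inf"
    using finite_subset[OF S(1)] below_subset[of n 0] by auto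
  then have mem: "card (boundary S) \<in> ?A"
    using S connected_compl_down_closed[of S] vertex_sets_below[of S n 0 n] card_cut[of S]
    by (intro CollectI exI[of _ S]) auto
  then have ne: "?A \<noteq> {}" by (metis empty_iff)
  from mem show "Inf ?A \<le> greedy n"
    using S(4) cInf_lower[of "card (boundary S)" ?A] by fastforce
  show "greedy n \<le> Inf ?A"
  proof (rule cInf_greatest[OF ne])
    fix a
    assume "a \<in> ?A"
    then obtain S where S: "S \<subseteq> pverts T_inf" "finite S" "card S = n" "a = card (cut S)"
      "induces_connected (pverts T_inf - S)"
      by (auto simp: vertex_sets_def)
    note bs = boundary_split[OF S(2,1)]
    have "n = (\<Sum>v\<in>upper_boundary S. mers (fst v))"
      using card_eq_boundary_sums[OF S(2,1)] S lower_boundary_empty by simp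
    then show "greedy n \<le> a"
      using greedy_sum[OF bs(1), of fst] bs(4) S card_cut lower_boundary_empty by simp
  qed
qed

text \<open>A connected set has a unique topmost vertex \<open>r\<close>, so
  \<open>mers (fst r) - n\<close> is a positive sum over the lower boundary. By
  \<open>greedy_mers_diff\<close> the smallest possible level of \<open>r\<close>,
  \<open>Suc d\<close>, is best.\<close>

lemma delta_C_eq:
  assumes "mers d < n" "n \<le> mers (Suc d)"
  shows "delta_C n = Suc (greedy (mers (Suc d) - n))"
  unfolding delta_C_def
proof (rule antisym)
  let ?A = "{card (cut S) |S. S \<in> vertex_sets n \<and> induces_connected S}"
  \<comment> \<open>The set to be removed fits into one child subtree, so the root stays in
    \<open>U\<close>.\<close>
  have "mers (Suc d) - n \<le> mers d" using assms by (simp add: mers_Suc)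
  then obtain S where S: "S \<subseteq> below d 0" "card S = mers (Suc d) - n" "down_closed S"
    "card (boundary S) \<le> greedy (mers (Suc d) - n)"
    using exists_set_greedy[of "mers (Suc d) - n" d 0] by blast
  define U where "U = below (Suc d) 0 - S"
  have sub: "below d 0 \<subseteq> below (Suc d) 0" by (auto simp: below_Suc)
  have finS: "finite S" using S(1) by (rule finite_subset) simp
  have U: "U \<subseteq> below (Suc d) 0" "(Suc d, 0) \<in> U"
    using S(1) root_notin_below[of d 0 0] by (auto simp: U_def below_Suc)
  have "card U = n"
    unfolding U_def using finS S sub assms by (subst card_Diff_subset) auto
  then have vU: "U \<in> vertex_sets n"
    using U(1) by (intro vertex_sets_below)
  have cU: "induces_connected U"
  proof (rule connected_if_rooted[OF U])
    fix v
    assume v: "v \<in> U" "v \<noteq> (Suc d, 0)"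
    then have b: "v \<in> below (Suc d) 0" "v \<notin> S" by (simp_all add: U_def)
    then have f: "fst v \<ge> 1" by (simp add: below_def)
    then have "parent v \<in> below (Suc d) 0"
      using b v(2) by (simp add: parent_in_below_iff)
    moreover have "parent v \<notin> S"
      using S(3) f b(2) unfolding down_closed_def by blast
    ultimately show "parent v \<in> U" by (simp add: U_def)
  qed
  have "card (cut U) = card (boundary U)"
    using U(1) below_subset[of "Suc d" 0] by (intro card_cut) auto
  then have mem: "card (boundary U) \<in> ?A"
    using vU cU by (intro CollectI exI[of _ U]) simp
  then have ne: "?A \<noteq> {}" by (metis empty_iff)
  have "Inf ?A \<le> card (boundary U)"
    using mem by (intro cInf_lower) auto
  also have "\<dots> \<le> Suc (greedy (mers (Suc d) - n))"
    unfolding U_def using S(1,4) by (rule card_boundary_below_Diff)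
  finally show "Inf ?A \<le> Suc (greedy (mers (Suc d) - n))" .
  show "Suc (greedy (mers (Suc d) - n)) \<le> Inf ?A"
  proof (rule cInf_greatest[OF ne])
    fix a
    assume "a \<in> ?A"
    then obtain S where S: "S \<subseteq> pverts T_inf" "finite S" "card S = n" "a = card (cut S)"
      "induces_connected S"
      by (auto simp: vertex_sets_def)
    note bs = boundary_split[OF S(2,1)]
    note sums = card_eq_boundary_sums[OF S(2,1)]
    have "upper_boundary S \<noteq> {}" using sums S(3) assms(1) by auto
    then obtain r where r: "upper_boundary S = {r}"
      using upper_boundary_unique[OF S(1,5)] by blast
    have eq: "n + (\<Sum>v\<in>lower_boundary S. mers (fst v)) = mers (fst r)"
      using sums S(3) r by simp
    then have "mers d < mers (fst r)" using assms(1) by linarith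
    then have "Suc d \<le> fst r" by (simp add: mers_less_iff)
    then have "greedy (mers (Suc d) - n) \<le> greedy (mers (fst r) - n)"
      using assms(2) by (intro greedy_mers_diff)
    also have "mers (fst r) - n = (\<Sum>v\<in>lower_boundary S. mers (fst v))"
      using eq by simp
    also have "greedy \<dots> \<le> card (lower_boundary S)"
      using bs(2) by (rule greedy_sum)
    finally show "Suc (greedy (mers (Suc d) - n)) \<le> a"
      using bs(4) r S(4) card_cut[OF S(1)] by simp
  qed
qed

subsection \<open>Duality\<close>

lemma dual_fun_mers: "k \<ge> 1 \<Longrightarrow> dual_fun (mers k) = mers k"
  by (auto simp: dual_fun_def mers_def)

text \<open>Here \<open>2 ^ d \<le> n < 2 ^ Suc d\<close>, so the logarithm is \<open>d\<close> and
  the formula for the dual is reflection of the interval between consecutive Mersenne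
  numbers.\<close>

lemma dual_fun_between:
  assumes "mers d < n" "n < mers (Suc d)"
  shows "dual_fun n = mers d + (mers (Suc d) - n)"
proof -
  have "n \<noteq> 2 ^ k - 1" for k
  proof
    assume "n = 2 ^ k - 1"
    then have "n = mers k" by (simp add: mers_def)
    with assms show False by (auto simp: mers_less_iff)
  qed
  moreover have n: "2 ^ d \<le> n" "n + 1 < 2 * 2 ^ d"
    using assms by (auto simp: mers_def)
  then have "n > 0" by (cases n) auto
  moreover have "floor_log n = d"
    using n \<open>n > 0\<close> by (intro floor_log_eqI) auto
  then have "nat \<lfloor>log 2 (real n)\<rfloor> = d"
    using \<open>n > 0\<close> by (simp add: floor_log_altdef)
  ultimately show ?thesis
    using n by (simp add: dual_fun_def mers_def)
qed

lemma dual_cases: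
  assumes "n \<ge> 1"
  obtains (mers) d where "n = mers (Suc d)" "dual_fun n = n"
  | (between) d where "d \<ge> 1" "mers d < n" "n < mers (Suc d)"
      "dual_fun n = mers d + (mers (Suc d) - n)"
proof -
  obtain d where d: "d \<ge> 1" "mers d \<le> n" "n < mers (Suc d)"
    using mers_interval[OF assms] .
  then obtain m where m: "d = Suc m" by (cases d) auto
  show thesis
  proof (cases "n = mers d")
    case True
    then show thesis using mers[of m] dual_fun_mers[OF d(1)] m by simp
  next
    case False
    then show thesis using between[of d] d dual_fun_between[of d n] by simp
  qed
qed

lemma dual_fun_ge_1:
  assumes "n \<ge> 1"
  shows "dual_fun n \<ge> 1"
  using assms by (cases rule: dual_cases) (use assms in auto)

lemma dual_fun_dual_fun:
  assumes "n \<ge> 1"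
  shows "dual_fun (dual_fun n) = n"
  using assms
proof (cases rule: dual_cases)
  case (between d)
  then have "dual_fun (dual_fun n) = mers d + (mers (Suc d) - dual_fun n)"
    by (intro dual_fun_between) (auto simp: mers_Suc)
  then show ?thesis using between by (simp add: mers_Suc)
qed simp

text \<open>Reflection stays within the interval between consecutive Mersenne numbers, so the dual
  respects the cutoffs in the counting claim.\<close>

lemma dual_fun_le_mers:
  assumes "n \<ge> 1" "n \<le> mers m"
  shows "dual_fun n \<le> mers m"
  using assms(1)
proof (cases rule: dual_cases)
  case (between d)
  then have "mers d < mers m" using assms(2) by linarith
  then have "mers (Suc d) \<le> mers m" by (intro mers_mono) (simp add: mers_less_iff)
  then show ?thesis using between by simp
qed (use assms in simp)

text \<open>Reflection swaps the two remainders in \<open>srep_iff\<close>.\<close>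

lemma delta_dual_fun:
  assumes "n \<ge> 1"
  shows "delta (dual_fun n) = delta n"
  using assms
proof (cases rule: dual_cases)
  case (between d)
  then have "dual_fun n - mers d = mers (Suc d) - n" "mers (Suc d) - dual_fun n = n - mers d"
    by simp_all
  then have "srep k (int (dual_fun n)) \<longleftrightarrow> srep k (int n)" for k
    using between srep_iff[of d n k] srep_iff[of d "dual_fun n" k] by auto
  then show ?thesis by (simp add: delta_eq)
qed simp

text \<open>Strictly between Mersenne numbers, the greedy expansion of the dual starts with
  \<open>mers d\<close> and leaves \<open>mers (Suc d) - n\<close>, the number in
  \<open>delta_C_eq\<close>. At a Mersenne number both sides are 1.\<close>

lemma delta_C_eq_delta_P_dual_fun:
  assumes "n \<ge> 1"
  shows "delta_C n = delta_P (dual_fun n)"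
  using assms
proof (cases rule: dual_cases)
  case (mers d)
  then show ?thesis
    using delta_C_eq[of d n] by (simp add: delta_P_eq greedy_mers mers_less)
next
  case (between d)
  then have "greedy (dual_fun n) = Suc (greedy (dual_fun n - mers d))"
    by (intro greedy_step) auto
  then show ?thesis
    using between delta_C_eq[of d n] by (simp add: delta_P_eq)
qed

text \<open>The dual is an involution, so \<open>delta_C\<close> of the dual of \<open>n\<close> is
  \<open>delta_P n\<close>, while \<open>delta\<close> is the same at both.\<close>

lemma X_iff_dual_Y:
  assumes "n \<ge> 1"
  shows "n \<in> X_set \<longleftrightarrow> dual_fun n \<in> Y_set"
  using assms delta_dual_fun[OF assms] delta_C_eq_delta_P_dual_fun[OF dual_fun_ge_1[OF assms]]
    dual_fun_ge_1[OF assms] dual_fun_dual_fun[OF assms]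
  by (simp add: X_set_def Y_set_def)

lemma Y_iff_dual_X:
  assumes "n \<ge> 1"
  shows "n \<in> Y_set \<longleftrightarrow> dual_fun n \<in> X_set"
  using X_iff_dual_Y[OF dual_fun_ge_1[OF assms]] dual_fun_dual_fun[OF assms] by simp

theorem theorem3p20:
  fixes n :: nat
  assumes "n \<ge> 1"
  shows "(n \<in> X_set \<longleftrightarrow> dual_fun n \<in> Y_set)
       \<and> (n \<in> Y_set \<longleftrightarrow> dual_fun n \<in> X_set)
       \<and> (\<forall>d::nat. card (X_below (2 ^ (d + 1))) = card (Y_below (2 ^ (d + 1))))"
proof (intro conjI allI)
  show "n \<in> X_set \<longleftrightarrow> dual_fun n \<in> Y_set" "n \<in> Y_set \<longleftrightarrow> dual_fun n \<in> X_set"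
    using assms by (rule X_iff_dual_Y, rule Y_iff_dual_X)
  fix d :: nat
  have less: "k < 2 ^ (d + 1) \<longleftrightarrow> k \<le> mers (d + 1)" for k :: nat
  proof -
    have "(1::nat) \<le> 2 ^ (d + 1)" by simp
    then show ?thesis unfolding mers_def by linarith
  qed
  have ge_1: "k \<ge> 1" if "k \<in> X_set \<or> k \<in> Y_set" for k
    using that by (auto simp: X_set_def Y_set_def)
  have "bij_betw dual_fun (X_below (2 ^ (d + 1))) (Y_below (2 ^ (d + 1)))"
    unfolding X_below_def Y_below_def less
  \<comment> \<open>The dual is its own inverse and, with the cutoff written as
    \<open>mers (d + 1)\<close>, preserves it.\<close>
  proof (rule bij_betw_byWitness[where f' = dual_fun])
    show "dual_fun ` {k \<in> X_set. k \<le> mers (d + 1)} \<subseteq> {k \<in> Y_set. k \<le> mers (d + 1)}"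
      using ge_1 X_iff_dual_Y dual_fun_le_mers by blast
    show "dual_fun ` {k \<in> Y_set. k \<le> mers (d + 1)} \<subseteq> {k \<in> X_set. k \<le> mers (d + 1)}"
      using ge_1 Y_iff_dual_X dual_fun_le_mers by blast
  qed (use ge_1 dual_fun_dual_fun in blast)+
  then show "card (X_below (2 ^ (d + 1))) = card (Y_below (2 ^ (d + 1)))"
    by (rule bij_betw_same_card)
qed

end
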